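(* Let $n,k,l$ be integers with $1<k<n$ and $1\le l<k$, and let $F$ be a smooth real-valued function of $n$ real variables $x_1,\dots,x_n$, defined near a point of $\mathbb{R}^n$, all of whose first partial derivatives $F_\alpha=\partial F/\partial x_\alpha$, $\alpha=1,\dots,n$, are nonvanishing. Then $F$ satisfies near that point the system of second-order nonlinear partial differential equations $$\frac{F_{pa}}{F_{pb}}=\frac{F_a}{F_b},\qquad p=1,\dots,l;\quad a,b=l+1,\dots,k,$$ understood as $F_{pa}F_b=F_{pb}F_a$, if and only if, near that point, $$F(x_1,\dots,x_n)=f\bigl(x_1,\dots,x_l,\,g(x_{l+1},\dots,x_k,x_{k+1},\dots,x_n),\,x_{k+1},\dots,x_n\bigr)$$ for some smooth real-valued functions $f$ and $g$ of $n-k+l+1$ and $n-l$ real variables, respectively. In other words, the general solution of the system is given by functions of this form.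
   Context: Subscripts denote partial derivatives: $F_\alpha=\partial F/\partial x_\alpha$ and $F_{\alpha\beta}=\partial^2F/\partial x_\alpha\partial x_\beta$. *)

theory Defs
  imports "HOL-Analysis.Analysis"
begin

text \<open>
  Functions of \<open>d\<close> real variables are rendered as maps \<open>real^'i \<Rightarrow> real\<close>, where the
  finite index type \<open>'i\<close> is numbered by some \<open>e\<close> with \<open>bij_betw e {1..d} UNIV\<close>;
  the coordinate \<open>x\<^sub>j\<close> of \<open>x\<close> is then \<open>x $ e j\<close>.
\<close>

definition point_of :: "(nat \<Rightarrow> 'i) \<Rightarrow> nat \<Rightarrow> (nat \<Rightarrow> real) \<Rightarrow> real^'i::finite" where
  "point_of e d c = (\<chi> i. c (inv_into {1..d} e i))"

lemma point_of_nth: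
  assumes "bij_betw e {1..d} UNIV" and "j \<in> {1..d}"
  shows "point_of e d c $ e j = c j"
  using assms by (simp add: point_of_def bij_betw_def inv_into_f_f)

definition partial_deriv :: "'i \<Rightarrow> (real^'i::finite \<Rightarrow> real) \<Rightarrow> real^'i \<Rightarrow> real" where
  "partial_deriv i f x = deriv (\<lambda>t. f (x + t *\<^sub>R axis i 1)) 0"

text \<open>
  \<open>C_on r U f\<close> is meant for open \<open>U\<close>: all partial derivatives of \<open>f\<close> of order at most
  \<open>r\<close> exist and are continuous on \<open>U\<close>.
\<close>

primrec C_on :: "nat \<Rightarrow> (real^'i::finite) set \<Rightarrow> (real^'i \<Rightarrow> real) \<Rightarrow> bool" where
  "C_on 0 U f \<longleftrightarrow> continuous_on U f"
| "C_on (Suc r) U f \<longleftrightarrow> continuous_on U f \<and>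
     (\<forall>i. (\<forall>x\<in>U. (\<lambda>t. f (x + t *\<^sub>R axis i 1)) differentiable (at 0)) \<and>
          C_on r U (partial_deriv i f))"

text \<open>
  Functions defined near a point are rendered as total functions that are constrained only
  on some open neighbourhood of the point; their values elsewhere are irrelevant.
\<close>

definition smooth_near :: "(real^'i::finite \<Rightarrow> real) \<Rightarrow> real^'i \<Rightarrow> bool" where
  "smooth_near f p \<longleftrightarrow> (\<exists>U. open U \<and> p \<in> U \<and> (\<forall>r. C_on r U f))"

text \<open>
  \<open>(x\<^sub>l\<^sub>+\<^sub>1, \<dots>, x\<^sub>n)\<close>, numbered from 1.
\<close>

definition inner_args ::
  "(nat \<Rightarrow> 'i) \<Rightarrow> (nat \<Rightarrow> 'j) \<Rightarrow> nat \<Rightarrow> nat \<Rightarrow> real^'i::finite \<Rightarrow> real^'j::finite" where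
  "inner_args e e' n l x = point_of e' (n - l) (\<lambda>j. x $ e (l + j))"

text \<open>
  \<open>(x\<^sub>1, \<dots>, x\<^sub>l, t, x\<^sub>k\<^sub>+\<^sub>1, \<dots>, x\<^sub>n)\<close>, numbered from 1.
\<close>

definition outer_args ::
  "(nat \<Rightarrow> 'i) \<Rightarrow> (nat \<Rightarrow> 'm) \<Rightarrow> nat \<Rightarrow> nat \<Rightarrow> nat \<Rightarrow> real \<Rightarrow> real^'i::finite \<Rightarrow> real^'m::finite" where
  "outer_args e e' n k l t x = point_of e' (n - k + l + 1)
     (\<lambda>j. if j \<le> l then x $ e j else if j = l + 1 then t else x $ e (k + (j - (l + 1))))"

end

theory Submission
  imports Defs
begin

text \<open>
  Write \<open>x = (x', y, z)\<close> for the blocks of variables numbered \<open>1..l\<close>, \<open>l+1..k\<close> and \<open>k+1..n\<close>, and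
  let \<open>c = l+1\<close>.

  If \<open>F = f (x', g (y, z), z)\<close>, then \<open>F\<^sub>a = f\<^sub>t g\<^sub>a\<close> and \<open>F\<^sub>p\<^sub>a = f\<^sub>t\<^sub>p g\<^sub>a\<close> for \<open>a\<close> in the
  second and \<open>p\<close> in the first block, and both sides of the equation are \<open>f\<^sub>t\<^sub>p f\<^sub>t g\<^sub>a g\<^sub>b\<close>
  (\<open>superposition_imp_system\<close>).

  Conversely, let \<open>F\<close> solve the system. The equations say that \<open>F\<^sub>a / F\<^sub>c\<close> does not depend on \<open>x'\<close>.
  Take for \<open>g\<close> the function \<open>F\<close> itself with \<open>x'\<close> frozen at the base point; then the gradients of
  \<open>F\<close> and \<open>g\<close> in the variables \<open>y\<close> are parallel, hence locally for fixed \<open>x'\<close> and \<open>z\<close> the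
  function \<open>F\<close> is constant on the level sets of \<open>g\<close>. To obtain a smooth \<open>f\<close>, the function \<open>g\<close> is
  introduced as a coordinate in place of \<open>x\<^sub>c\<close>, which is possible near the base point because
  \<open>F\<^sub>c\<close> does not vanish there (\<open>smooth_local_inverse\<close>); in the new coordinates \<open>F\<close> has vanishing
  derivatives in the other variables of \<open>y\<close>, and freezing these at the base point leaves \<open>f\<close>
  (\<open>system_imp_superposition\<close>).

  Smoothness means existence and continuity of all iterated partial derivatives, so the
  argument rests on a small calculus for these classes: closure under products, reciprocals
  and composition. The composition rule depends on the fact that continuous partial
  derivatives imply total differentiability (\<open>C1_has_derivative\<close>).
\<close>

section \<open>Partial derivatives and the classes of r times continuously differentiable functions\<close>

text \<open>
  The function \<open>partial_deriv\<close> has a value even where the derivative does not exist; this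
  relation also carries existence, so that the usual derivative rules can be chained.
\<close>

definition has_partial :: "(real^'i::finite \<Rightarrow> real) \<Rightarrow> real \<Rightarrow> 'i \<Rightarrow> real^'i \<Rightarrow> bool" where
  "has_partial f D i x \<longleftrightarrow> ((\<lambda>t. f (x + t *\<^sub>R axis i 1)) has_real_derivative D) (at 0)"

lemma has_partial_imp_partial_deriv: "has_partial f D i x \<Longrightarrow> partial_deriv i f x = D"
  unfolding has_partial_def partial_deriv_def by (rule DERIV_imp_deriv)

lemma has_partial_line:
  assumes "has_partial f D i (x + t *\<^sub>R axis i 1)"
  shows "((\<lambda>s. f (x + s *\<^sub>R axis i 1)) has_real_derivative D) (at t)"
proof -
  have "((\<lambda>s. f (x + (s + t) *\<^sub>R axis i 1)) has_real_derivative D) (at 0)"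
    using assms unfolding has_partial_def by (simp add: algebra_simps)
  then show ?thesis
    using DERIV_shift[of "\<lambda>s. f (x + s *\<^sub>R axis i 1)" D 0 t] by simp
qed

lemma eventually_along_axis:
  fixes x :: "real^'i::finite"
  assumes "eventually Q (nhds x)"
  shows "\<forall>\<^sub>F t in nhds 0. Q (x + t *\<^sub>R axis i 1)"
proof -
  have "((\<lambda>t. x + t *\<^sub>R axis i 1) \<longlongrightarrow> x + 0 *\<^sub>R axis i 1) (nhds (0::real))"
    by (intro tendsto_add tendsto_scaleR tendsto_const filterlim_ident)
  then have "filterlim (\<lambda>t. x + t *\<^sub>R axis i 1) (nhds x) (nhds (0::real))"
    by simp
  with assms show ?thesis
    by (rule eventually_compose_filterlim)
qed

lemma has_partial_cong_ev:
  assumes "\<forall>\<^sub>F y in nhds x. f y = g y"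
  shows "has_partial f D i x \<longleftrightarrow> has_partial g D i x"
  unfolding has_partial_def
  by (rule DERIV_cong_ev) (use eventually_along_axis[OF assms] in auto)

lemma has_partial_cong:
  assumes "open U" "x \<in> U" "\<And>y. y \<in> U \<Longrightarrow> f y = g y"
  shows "has_partial f D i x \<longleftrightarrow> has_partial g D i x"
  using assms by (intro has_partial_cong_ev) (auto simp: eventually_nhds)

lemma has_partial_mult:
  assumes "has_partial f D i x" "has_partial g E i x"
  shows "has_partial (\<lambda>x. f x * g x) (D * g x + f x * E) i x"
  using DERIV_mult[OF assms[unfolded has_partial_def]]
  by (simp add: has_partial_def mult.commute add.commute)

lemma has_partial_inverse:
  assumes "has_partial f D i x" "f x \<noteq> 0"
  shows "has_partial (\<lambda>x. inverse (f x)) (- (inverse (f x) * D * inverse (f x))) i x"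
  using DERIV_inverse'[OF assms(1)[unfolded has_partial_def]] assms(2)
  by (simp add: has_partial_def)

lemma has_partial_coord: "has_partial (\<lambda>x. x $ j) (if i = j then 1 else 0) i x"
  unfolding has_partial_def by (auto intro!: derivative_eq_intros simp: axis_def)

lemma C_on_imp_continuous: "C_on r U f \<Longrightarrow> continuous_on U f"
  by (cases r) auto

lemma C_on_partial_deriv: "C_on (Suc r) U f \<Longrightarrow> C_on r U (partial_deriv i f)"
  by simp

lemma C_on_has_partial:
  assumes "C_on (Suc r) U f" "x \<in> U"
  shows "has_partial f (partial_deriv i f x) i x"
  using assms unfolding has_partial_def partial_deriv_def
  by (simp add: DERIV_deriv_iff_real_differentiable)

lemma C_on_subset: "C_on r U f \<Longrightarrow> V \<subseteq> U \<Longrightarrow> C_on r V f"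
  by (induction r arbitrary: f) (auto intro: continuous_on_subset)

lemma C_on_Suc_imp: "C_on (Suc r) U f \<Longrightarrow> C_on r U f"
  by (induction r arbitrary: f) auto

text \<open>
  Openness of \<open>U\<close> is essential: a partial derivative at a point of \<open>U\<close> depends on the function
  at nearby points, and these must belong to \<open>U\<close> as well.
\<close>

lemma C_on_cong_imp:
  assumes "open U" "\<And>x. x \<in> U \<Longrightarrow> f x = g x" "C_on r U f"
  shows "C_on r U g"
  using assms(2,3)
proof (induction r arbitrary: f g)
  case 0
  then show ?case by (simp cong: continuous_on_cong)
next
  case (Suc r)
  have g: "has_partial g (partial_deriv i f x) i x" if "x \<in> U" for i x
    using C_on_has_partial[OF Suc.prems(2) that] has_partial_cong[OF assms(1) that, of f g] Suc.prems(1)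
    by blast
  have "C_on r U (partial_deriv i g)" for i
    by (rule Suc.IH[OF _ C_on_partial_deriv[OF Suc.prems(2)]])
       (simp add: has_partial_imp_partial_deriv[OF g])
  moreover have "(\<lambda>t. g (x + t *\<^sub>R axis i 1)) differentiable (at 0)" if "x \<in> U" for i x
    using g[OF that] unfolding has_partial_def
    by (auto simp: real_differentiable_def)
  moreover have "continuous_on U g"
    using Suc.prems C_on_imp_continuous by (metis continuous_on_cong)
  ultimately show ?case by simp
qed

text \<open>
  The form in which differentiability classes are established below: the partial derivatives
  only have to be computed on \<open>U\<close>, by formulas \<open>D i\<close> that may differ from them elsewhere.
\<close>

lemma C_on_SucI:
  assumes "open U" "continuous_on U f"
    and "\<And>i x. x \<in> U \<Longrightarrow> has_partial f (D i x) i x"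
    and "\<And>i. C_on r U (D i)"
  shows "C_on (Suc r) U f"
proof -
  have "C_on r U (partial_deriv i f)" for i
    by (rule C_on_cong_imp[OF assms(1) _ assms(4)[of i]])
       (simp add: has_partial_imp_partial_deriv[OF assms(3)])
  moreover have "(\<lambda>t. f (x + t *\<^sub>R axis i 1)) differentiable (at 0)" if "x \<in> U" for i x
    using assms(3)[OF that] unfolding has_partial_def
    by (auto simp: real_differentiable_def)
  ultimately show ?thesis using assms(2) by simp
qed

lemma C_on_const: "open U \<Longrightarrow> C_on r U (\<lambda>_. c)"
proof (induction r arbitrary: c)
  case (Suc r)
  show ?case
    by (rule C_on_SucI[where D = "\<lambda>_ _. 0"]) (auto simp: has_partial_def Suc)
qed auto

lemma C_on_coord: "open U \<Longrightarrow> C_on r U (\<lambda>x. x $ j)"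
proof (cases r)
  case (Suc r)
  assume "open U"
  then show ?thesis
    unfolding Suc
    by (intro C_on_SucI[where D = "\<lambda>i _. if i = j then 1 else 0"] C_on_const has_partial_coord)
       (auto intro!: continuous_intros)
qed (auto intro!: continuous_intros)

lemma C_on_add:
  assumes "open U" "C_on r U f" "C_on r U g"
  shows "C_on r U (\<lambda>x. f x + g x)"
  using assms(2,3)
proof (induction r arbitrary: f g)
  case (Suc r)
  show ?case
  proof (rule C_on_SucI[OF assms(1)])
    show "has_partial (\<lambda>x. f x + g x) (partial_deriv i f x + partial_deriv i g x) i x"
      if "x \<in> U" for i x
      using C_on_has_partial[OF Suc.prems(1) that] C_on_has_partial[OF Suc.prems(2) that]
      unfolding has_partial_def by (intro DERIV_add)
    show "C_on r U (\<lambda>x. partial_deriv i f x + partial_deriv i g x)" for i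
      by (intro Suc.IH C_on_partial_deriv Suc.prems)
  qed (intro continuous_intros C_on_imp_continuous[OF Suc.prems(1)] C_on_imp_continuous[OF Suc.prems(2)])
qed (auto intro: continuous_intros)

lemma C_on_sum:
  assumes "open U" "\<And>j. j \<in> S \<Longrightarrow> C_on r U (f j)"
  shows "C_on r U (\<lambda>x. \<Sum>j\<in>S. f j x)"
  using assms(2) by (induction S rule: infinite_finite_induct) (auto intro: C_on_const C_on_add assms(1))

lemma C_on_mult:
  assumes "open U" "C_on r U f" "C_on r U g"
  shows "C_on r U (\<lambda>x. f x * g x)"
  using assms(2,3)
proof (induction r arbitrary: f g)
  case (Suc r)
  show ?case
  proof (rule C_on_SucI[OF assms(1)])
    show "has_partial (\<lambda>x. f x * g x) (partial_deriv i f x * g x + f x * partial_deriv i g x) i x"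
      if "x \<in> U" for i x
      by (intro has_partial_mult C_on_has_partial[OF Suc.prems(1) that] C_on_has_partial[OF Suc.prems(2) that])
    show "C_on r U (\<lambda>x. partial_deriv i f x * g x + f x * partial_deriv i g x)" for i
      by (intro C_on_add assms(1) Suc.IH C_on_partial_deriv[OF Suc.prems(1)]
          C_on_partial_deriv[OF Suc.prems(2)] C_on_Suc_imp[OF Suc.prems(1)] C_on_Suc_imp[OF Suc.prems(2)])
  qed (intro continuous_intros C_on_imp_continuous[OF Suc.prems(1)] C_on_imp_continuous[OF Suc.prems(2)])
qed (auto intro: continuous_intros)

lemma C_on_inverse:
  assumes "open U" "C_on r U f" "\<And>x. x \<in> U \<Longrightarrow> f x \<noteq> 0"
  shows "C_on r U (\<lambda>x. inverse (f x))"
  using assms(2)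
proof (induction r)
  case 0
  then show ?case using assms(3) by (auto intro!: continuous_intros)
next
  case (Suc r)
  have inv: "C_on r U (\<lambda>x. inverse (f x))"
    by (rule Suc.IH[OF C_on_Suc_imp[OF Suc.prems]])
  show ?case
  proof (rule C_on_SucI[OF assms(1)])
    show "has_partial (\<lambda>x. inverse (f x))
        (- 1 * (inverse (f x) * partial_deriv i f x * inverse (f x))) i x" if "x \<in> U" for i x
      using has_partial_inverse[OF C_on_has_partial[OF Suc.prems that] assms(3)[OF that]] by simp
    show "C_on r U (\<lambda>x. - 1 * (inverse (f x) * partial_deriv i f x * inverse (f x)))" for i
      by (intro C_on_mult C_on_const assms(1) inv C_on_partial_deriv[OF Suc.prems])
  qed (use assms(3) C_on_imp_continuous[OF Suc.prems] in \<open>auto intro!: continuous_intros\<close>)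
qed

lemma C_on_continuous_at:
  assumes "open U" "C_on r U f" "x \<in> U"
  shows "isCont f x"
  using C_on_imp_continuous[OF assms(2)] assms(1,3) by (simp add: continuous_on_eq_continuous_at)

text \<open>
  Changing the coordinates one at a time splits the increment of \<open>f\<close> into increments along
  the axes, each of which is controlled by the mean value inequality, because the partial
  derivatives near \<open>x\<close> are close to those at \<open>x\<close>. All intermediate points stay within
  distance \<open>norm h\<close> of \<open>x\<close>, since their offsets from \<open>x\<close> are componentwise dominated by \<open>h\<close>.
\<close>

lemma C1_has_derivative:
  fixes f :: "real^'n::finite \<Rightarrow> real"
  assumes U: "open U" and f: "C_on (Suc r) U f" and x: "x \<in> U"
  shows "(f has_derivative (\<lambda>h. \<Sum>i\<in>UNIV. h $ i * partial_deriv i f x)) (at x)"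
  unfolding has_derivative_at_alt
proof (intro conjI allI impI)
  show "bounded_linear (\<lambda>h. \<Sum>i\<in>UNIV. h $ i * partial_deriv i f x)"
    by (intro bounded_linear_sum bounded_linear_mult_const bounded_linear_vec_nth)
next
  fix \<epsilon> :: real assume "\<epsilon> > 0"
  define \<eta> where "\<eta> = \<epsilon> / real CARD('n)"
  have "\<eta> > 0" using \<open>\<epsilon> > 0\<close> by (simp add: \<eta>_def)
  have "\<forall>\<^sub>F y in nhds x. \<forall>i. dist (partial_deriv i f y) (partial_deriv i f x) < \<eta>"
  proof (rule eventually_all_finite)
    fix i
    have "isCont (partial_deriv i f) x"
      by (rule C_on_continuous_at[OF U C_on_partial_deriv[OF f] x])
    then show "\<forall>\<^sub>F y in nhds x. dist (partial_deriv i f y) (partial_deriv i f x) < \<eta>"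
      using \<open>\<eta> > 0\<close> unfolding isCont_def tendsto_at_iff_tendsto_nhds by (rule tendstoD)
  qed
  moreover have "\<forall>\<^sub>F y in nhds x. y \<in> U"
    using U x by (rule eventually_nhds_in_open)
  ultimately have "\<forall>\<^sub>F y in nhds x. y \<in> U \<and> (\<forall>i. dist (partial_deriv i f y) (partial_deriv i f x) < \<eta>)"
    by eventually_elim auto
  then obtain \<delta> where \<delta>: "\<delta> > 0" "\<And>y. dist y x < \<delta> \<Longrightarrow> y \<in> U"
    "\<And>y i. dist y x < \<delta> \<Longrightarrow> \<bar>partial_deriv i f y - partial_deriv i f x\<bar> < \<eta>"
    unfolding eventually_nhds_metric by (auto simp: dist_real_def)
  \<comment> \<open>Induction over the set of coordinates that \<open>h\<close> is allowed to change.\<close>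
  have *: "\<bar>f (x + h) - f x - (\<Sum>i\<in>S. h $ i * partial_deriv i f x)\<bar> \<le> \<eta> * (\<Sum>i\<in>S. \<bar>h $ i\<bar>)"
    if "finite S" "norm h < \<delta>" "\<And>i. i \<notin> S \<Longrightarrow> h $ i = 0" for S h
    using that
  proof (induction S arbitrary: h)
    case empty
    then have "h = 0" by (simp add: vec_eq_iff)
    then show ?case by simp
  next
    case (insert j S)
    define h' where "h' = (\<chi> i. if i = j then 0 else h $ i)"
    have h: "h = h' + (h $ j) *\<^sub>R axis j 1"
      by (auto simp: vec_eq_iff h'_def axis_def)
    have near: "norm (h' + s *\<^sub>R axis j 1) < \<delta>" if "\<bar>s\<bar> \<le> \<bar>h $ j\<bar>" for s
    proof -
      have "norm (h' + s *\<^sub>R axis j 1) \<le> norm h"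
        using that by (intro norm_le_componentwise_cart) (auto simp: h'_def axis_def)
      then show ?thesis using insert.prems by simp
    qed
    have IH: "\<bar>f (x + h') - f x - (\<Sum>i\<in>S. h' $ i * partial_deriv i f x)\<bar> \<le> \<eta> * (\<Sum>i\<in>S. \<bar>h' $ i\<bar>)"
      using near[of 0] insert.prems by (intro insert.IH) (auto simp: h'_def)
    have S: "(\<Sum>i\<in>S. h' $ i * partial_deriv i f x) = (\<Sum>i\<in>S. h $ i * partial_deriv i f x)"
      "(\<Sum>i\<in>S. \<bar>h' $ i\<bar>) = (\<Sum>i\<in>S. \<bar>h $ i\<bar>)"
      using insert.hyps by (auto intro!: sum.cong simp: h'_def)
    define \<phi> where "\<phi> s = f (x + h' + s *\<^sub>R axis j 1) - s * partial_deriv j f x" for s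
    let ?I = "{- \<bar>h $ j\<bar> .. \<bar>h $ j\<bar>}"
    have "norm (\<phi> (h $ j) - \<phi> 0) \<le> \<eta> * norm (h $ j - 0)"
    proof (rule field_differentiable_bound[where S = ?I
          and f' = "\<lambda>s. partial_deriv j f (x + h' + s *\<^sub>R axis j 1) - partial_deriv j f x"])
      fix s assume "s \<in> ?I"
      then have s: "dist (x + h' + s *\<^sub>R axis j 1) x < \<delta>"
        using near[of s] by (auto simp: dist_norm algebra_simps)
      show "norm (partial_deriv j f (x + h' + s *\<^sub>R axis j 1) - partial_deriv j f x) \<le> \<eta>"
        using \<delta>(3)[OF s, of j] by simp
      show "(\<phi> has_field_derivative
          partial_deriv j f (x + h' + s *\<^sub>R axis j 1) - partial_deriv j f x) (at s within ?I)"
        unfolding \<phi>_def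
        by (rule DERIV_diff[OF DERIV_subset[OF has_partial_line[OF C_on_has_partial[OF f \<delta>(2)[OF s]]] subset_UNIV]])
           (auto intro!: derivative_eq_intros)
    qed auto
    then have "\<bar>f (x + h) - f (x + h') - h $ j * partial_deriv j f x\<bar> \<le> \<eta> * \<bar>h $ j\<bar>"
      using h by (simp add: \<phi>_def add.assoc)
    with IH insert.hyps show ?case
      unfolding S by (simp add: algebra_simps) 
  qed
  show "\<exists>d>0. \<forall>y. norm (y - x) < d \<longrightarrow>
      norm (f y - f x - (\<Sum>i\<in>UNIV. (y - x) $ i * partial_deriv i f x)) \<le> \<epsilon> * norm (y - x)"
  proof (intro exI[of _ \<delta>] conjI allI impI \<delta>(1))
    fix y assume y: "norm (y - x) < \<delta>"
    have "\<bar>f (x + (y - x)) - f x - (\<Sum>i\<in>UNIV. (y - x) $ i * partial_deriv i f x)\<bar>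
        \<le> \<eta> * (\<Sum>i\<in>UNIV. \<bar>(y - x) $ i\<bar>)"
      using y by (intro *) auto
    also have "\<dots> \<le> \<eta> * (\<Sum>i\<in>(UNIV::'n set). norm (y - x))"
      using \<open>\<eta> > 0\<close> by (intro mult_left_mono sum_mono component_le_norm_cart) auto
    finally show "norm (f y - f x - (\<Sum>i\<in>UNIV. (y - x) $ i * partial_deriv i f x)) \<le> \<epsilon> * norm (y - x)"
      using \<open>\<eta> > 0\<close> by (simp add: \<eta>_def)
  qed
qed

lemma continuous_on_vecI:
  fixes \<phi> :: "'a::topological_space \<Rightarrow> real^'n"
  assumes "\<And>j. continuous_on U (\<lambda>x. \<phi> x $ j)"
  shows "continuous_on U \<phi>"
  using continuous_on_vec_lambda[of U "\<lambda>j x. \<phi> x $ j"] assms by (simp add: vec_lambda_eta)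

lemma has_derivative_vec:
  fixes \<phi> :: "'a::real_normed_vector \<Rightarrow> real^'n::finite"
  assumes "\<And>j. ((\<lambda>x. \<phi> x $ j) has_derivative (\<lambda>h. \<phi>' h $ j)) (at a)"
  shows "(\<phi> has_derivative \<phi>') (at a)"
  using assms unfolding has_derivative_componentwise_within[of \<phi> \<phi>' a UNIV]
  by (auto simp: Basis_vec_def inner_axis)

lemma has_partial_compose:
  fixes f :: "real^'n::finite \<Rightarrow> real" and \<phi> :: "real^'m::finite \<Rightarrow> real^'n"
  assumes V: "open V" "C_on (Suc r) V f" "\<phi> x \<in> V"
    and \<phi>: "\<And>j. has_partial (\<lambda>x. \<phi> x $ j) (D j) i x"
  shows "has_partial (\<lambda>x. f (\<phi> x)) (\<Sum>j\<in>UNIV. D j * partial_deriv j f (\<phi> x)) i x"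
proof -
  have "((\<lambda>t. \<phi> (x + t *\<^sub>R axis i 1)) has_derivative (\<lambda>t. \<chi> j. D j * t)) (at 0)"
    by (rule has_derivative_vec)
       (use \<phi> in \<open>auto simp: has_partial_def has_field_derivative_def\<close>)
  moreover have "(f has_derivative (\<lambda>h. \<Sum>j\<in>UNIV. h $ j * partial_deriv j f (\<phi> x)))
      (at (\<phi> (x + 0 *\<^sub>R axis i 1)))"
    using C1_has_derivative[OF V] by simp
  ultimately have "((\<lambda>t. f (\<phi> (x + t *\<^sub>R axis i 1))) has_derivative
      (\<lambda>t. \<Sum>j\<in>UNIV. (\<chi> j. D j * t) $ j * partial_deriv j f (\<phi> x))) (at 0)"
    by (rule has_derivative_compose)
  then show ?thesis
    unfolding has_partial_def has_field_derivative_def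
    by (rule has_derivative_eq_rhs) (simp add: fun_eq_iff sum_distrib_left mult_ac)
qed

text \<open>
  By the chain rule a partial derivative of the composition is a sum of products of functions
  \<open>partial_deriv j f \<circ> \<phi>\<close> with partial derivatives of \<open>\<phi>\<close>; the induction hypothesis for the
  former is why \<open>f\<close> is arbitrary in the induction.
\<close>

lemma C_on_compose:
  fixes f :: "real^'n::finite \<Rightarrow> real" and \<phi> :: "real^'m::finite \<Rightarrow> real^'n"
  assumes U: "open U" and V: "open V" and UV: "\<And>x. x \<in> U \<Longrightarrow> \<phi> x \<in> V"
    and "\<And>j. C_on r U (\<lambda>x. \<phi> x $ j)" and "C_on r V f"
  shows "C_on r U (\<lambda>x. f (\<phi> x))"
  using assms(4,5)
proof (induction r arbitrary: f)
  case 0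
  then have "continuous_on U \<phi>"
    by (intro continuous_on_vecI) auto
  then show ?case
    using 0 UV by (auto intro!: continuous_on_compose2[of V f])
next
  case (Suc r)
  have cont: "C_on 0 U (\<lambda>x. f (\<phi> x))"
  proof -
    have "continuous_on U \<phi>"
      by (intro continuous_on_vecI C_on_imp_continuous[OF Suc.prems(1)])
    then show ?thesis
      using C_on_imp_continuous[OF Suc.prems(2)] UV by (auto intro!: continuous_on_compose2[of V f])
  qed
  show ?case
  proof (rule C_on_SucI[OF U])
    show "has_partial (\<lambda>x. f (\<phi> x))
        (\<Sum>j\<in>UNIV. partial_deriv i (\<lambda>x. \<phi> x $ j) x * partial_deriv j f (\<phi> x)) i x" if "x \<in> U" for i x
      by (rule has_partial_compose[where D = "\<lambda>j. partial_deriv i (\<lambda>x. \<phi> x $ j) x",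
            OF V Suc.prems(2) UV[OF that] C_on_has_partial[OF Suc.prems(1) that]])
    show "C_on r U (\<lambda>x. \<Sum>j\<in>UNIV. partial_deriv i (\<lambda>x. \<phi> x $ j) x * partial_deriv j f (\<phi> x))" for i
      by (rule C_on_sum[OF U C_on_mult[OF U C_on_partial_deriv[OF Suc.prems(1)]
              Suc.IH[OF C_on_Suc_imp[OF Suc.prems(1)] C_on_partial_deriv[OF Suc.prems(2)]]]])
  qed (use cont in simp)
qed

section \<open>Mean values and constancy on convex sets\<close>

lemma segment_mvt:
  fixes f :: "real^'n::finite \<Rightarrow> real"
  assumes W: "open W" "convex W" and f: "C_on (Suc r) W f" and xy: "x \<in> W" "y \<in> W"
  obtains z where "z \<in> W" "f y - f x = (\<Sum>i\<in>UNIV. (y $ i - x $ i) * partial_deriv i f z)"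
proof -
  define \<gamma> where "\<gamma> t = x + t *\<^sub>R (y - x)" for t
  have \<gamma>W: "\<gamma> t \<in> W" if "0 \<le> t" "t \<le> 1" for t
    using convexD_alt[OF W(2) xy that] by (simp add: \<gamma>_def algebra_simps)
  have "((\<lambda>t. f (\<gamma> t)) has_real_derivative
      (\<Sum>i\<in>UNIV. (y $ i - x $ i) * partial_deriv i f (\<gamma> t))) (at t)" if t: "0 \<le> t" "t \<le> 1" for t
  proof -
    have "(\<gamma> has_derivative (\<lambda>s. s *\<^sub>R (y - x))) (at t)"
      unfolding \<gamma>_def by (auto intro!: derivative_eq_intros)
    from has_derivative_compose[OF this C1_has_derivative[OF W(1) f \<gamma>W[OF t]]]
    show ?thesis
      unfolding has_field_derivative_def
      by (rule has_derivative_eq_rhs) (simp add: fun_eq_iff sum_distrib_left mult_ac)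
  qed
  then obtain t where "0 < t" "t < 1" and
    t: "f (\<gamma> 1) - f (\<gamma> 0) = (1 - 0) * (\<Sum>i\<in>UNIV. (y $ i - x $ i) * partial_deriv i f (\<gamma> t))"
    using MVT2[of 0 1 "\<lambda>t. f (\<gamma> t)"
        "\<lambda>t. \<Sum>i\<in>UNIV. (y $ i - x $ i) * partial_deriv i f (\<gamma> t)"] by auto
  show thesis
    using \<gamma>W[of t] \<open>0 < t\<close> \<open>t < 1\<close> t by (intro that[of "\<gamma> t"]) (auto simp: \<gamma>_def)
qed

text \<open>
  Since only the coordinates in which \<open>x\<close> and \<open>y\<close> differ enter the mean value formula, the
  other partial derivatives of \<open>f\<close> may be arbitrary. This is how a function is shown to be
  independent of a group of variables.
\<close>

lemma eq_if_partials_vanish: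
  fixes f :: "real^'n::finite \<Rightarrow> real"
  assumes W: "open W" "convex W" and f: "C_on (Suc r) W f" and xy: "x \<in> W" "y \<in> W"
    and zero: "\<And>i z. z \<in> W \<Longrightarrow> x $ i \<noteq> y $ i \<Longrightarrow> partial_deriv i f z = 0"
  shows "f x = f y"
proof -
  obtain z where z: "z \<in> W" "f y - f x = (\<Sum>i\<in>UNIV. (y $ i - x $ i) * partial_deriv i f z)"
    by (rule segment_mvt[OF assms(1-5)])
  have "(y $ i - x $ i) * partial_deriv i f z = 0" for i
    using zero[OF z(1), of i] by (cases "x $ i = y $ i") auto
  then show ?thesis using z(2) by (simp only: sum.neutral_const)
qed

section \<open>Taking a function as a new coordinate\<close>

definition replace_coord :: "'n \<Rightarrow> real \<Rightarrow> real^'n::finite \<Rightarrow> real^'n" where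
  "replace_coord c t x = (\<chi> i. if i = c then t else x $ i)"

lemma replace_coord_nth [simp]: "replace_coord c t x $ i = (if i = c then t else x $ i)"
  by (simp add: replace_coord_def)

text \<open>
  The map \<open>\<Phi>\<close> uses \<open>G\<close> as the new coordinate number \<open>c\<close> and keeps the others. It is injective
  because \<open>G\<close> is strictly monotone in \<open>x\<^sub>c\<close> on the convex set \<open>W\<close>, so invariance of domain
  yields an open image and a continuous inverse. Inverting the Jacobian matrix, which differs
  from the identity only in row \<open>c\<close>, gives the derivative of the inverse. Its entries are
  rational expressions in the functions \<open>partial_deriv i G \<circ> \<Psi>\<close>, which are as often
  differentiable as \<open>\<Psi>\<close>, so that \<open>\<Psi>\<close> is once more differentiable than known before:
  smoothness follows by bootstrapping.
\<close>

lemma smooth_local_inverse: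
  fixes G :: "real^'n::finite \<Rightarrow> real" and c :: 'n
  assumes W: "open W" "convex W" and G: "\<And>r. C_on r W G"
    and nz: "\<And>x. x \<in> W \<Longrightarrow> partial_deriv c G x \<noteq> 0"
  defines "\<Phi> \<equiv> \<lambda>x. replace_coord c (G x) x"
  obtains \<Psi> where "open (\<Phi> ` W)"
    and "\<And>x. x \<in> W \<Longrightarrow> \<Psi> (\<Phi> x) = x"
    and "\<And>r j. C_on r (\<Phi> ` W) (\<lambda>u. \<Psi> u $ j)"
    and "\<And>i j u. u \<in> \<Phi> ` W \<Longrightarrow> i \<noteq> c \<Longrightarrow> has_partial (\<lambda>u. \<Psi> u $ j)
      (if j = c then - (partial_deriv i G (\<Psi> u) / partial_deriv c G (\<Psi> u)) else if i = j then 1 else 0) i u"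
proof -
  let ?V = "\<Phi> ` W"
  let ?g = "\<lambda>i x. partial_deriv i G x"
  have \<Phi>j: "\<Phi> x $ j = (if j = c then G x else x $ j)" for x j
    by (simp add: \<Phi>_def)
  have inj: "inj_on \<Phi> W"
  proof (rule inj_onI)
    fix x y assume xy: "x \<in> W" "y \<in> W" "\<Phi> x = \<Phi> y"
    have eq: "x $ i = y $ i" if "i \<noteq> c" for i
      using that xy(3) \<Phi>j by metis
    have Geq: "G x = G y"
      using xy(3) \<Phi>j[of _ c] by metis
    obtain z where z: "z \<in> W" "G y - G x = (\<Sum>i\<in>UNIV. (y $ i - x $ i) * ?g i z)"
      by (rule segment_mvt[OF W G[of "Suc 0"] xy(1,2)])
    have "(\<Sum>i\<in>UNIV. (y $ i - x $ i) * ?g i z) = (\<Sum>i\<in>{c}. (y $ i - x $ i) * ?g i z)"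
      by (rule sum.mono_neutral_right) (auto simp: eq)
    then have "y $ c = x $ c"
      using z Geq nz by simp
    with eq show "x = y"
      by (metis vec_eq_iff)
  qed
  have cont: "continuous_on W \<Phi>"
  proof (rule continuous_on_vecI)
    show "continuous_on W (\<lambda>x. \<Phi> x $ j)" for j
      using C_on_imp_continuous[OF G] by (cases "j = c") (auto simp: \<Phi>j intro!: continuous_intros)
  qed
  have V: "open ?V"
    by (rule invariance_of_domain[OF cont W(1) inj])
  obtain \<Psi> where hom: "homeomorphism W ?V \<Phi> \<Psi>"
    using invariance_of_domain_homeomorphism[OF W(1) cont _ inj] by auto
  have \<Psi>W: "\<Psi> u \<in> W" and \<Phi>\<Psi>: "\<Phi> (\<Psi> u) = u" if "u \<in> ?V" for u
    using hom that by (auto simp: homeomorphism_def)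
  have \<Psi>\<Phi>: "\<Psi> (\<Phi> x) = x" if "x \<in> W" for x
    using hom that by (auto simp: homeomorphism_def)
  have cont\<Psi>: "continuous_on ?V \<Psi>"
    using hom by (auto simp: homeomorphism_def)
  \<comment> \<open>Solving \<open>h = D\<Phi> k\<close> for \<open>k\<close>: only the component \<open>c\<close> has to be computed.\<close>
  define D\<Psi> where "D\<Psi> u h = (\<chi> j. if j = c then
      (h $ c - (\<Sum>i\<in>UNIV - {c}. h $ i * ?g i (\<Psi> u))) * inverse (?g c (\<Psi> u)) else h $ j)" for u h
  have der: "(\<Psi> has_derivative D\<Psi> u) (at u)" if u: "u \<in> ?V" for u
  proof (rule has_derivative_inverse_basic)
    show "open ?V" "u \<in> ?V" by (rule V, rule u)
    show "\<Phi> (\<Psi> z) = z" if "z \<in> ?V" for z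
      using that by (rule \<Phi>\<Psi>)
    let ?D\<Phi> = "\<lambda>h. \<chi> j. if j = c then (\<Sum>i\<in>UNIV. h $ i * ?g i (\<Psi> u)) else h $ j"
    show "(\<Phi> has_derivative ?D\<Phi>) (at (\<Psi> u))"
    proof (rule has_derivative_vec)
      show "((\<lambda>x. \<Phi> x $ j) has_derivative (\<lambda>h. ?D\<Phi> h $ j)) (at (\<Psi> u))" for j
        using C1_has_derivative[OF W(1) G[of "Suc 0"] \<Psi>W[OF u]]
        by (cases "j = c") (auto simp: \<Phi>j intro: bounded_linear_imp_has_derivative bounded_linear_vec_nth)
    qed
    show "bounded_linear (D\<Psi> u)"
      unfolding linear_conv_bounded_linear[symmetric] D\<Psi>_def
      by (rule linearI) (auto simp: vec_eq_iff algebra_simps sum.distrib sum_distrib_left)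
    show "D\<Psi> u \<circ> ?D\<Phi> = id"
    proof
      fix h
      have "(\<Sum>i\<in>UNIV. h $ i * ?g i (\<Psi> u)) = h $ c * ?g c (\<Psi> u) + (\<Sum>i\<in>UNIV - {c}. h $ i * ?g i (\<Psi> u))"
        by (rule sum.remove) auto
      moreover have "(\<Sum>i\<in>UNIV - {c}. ?D\<Phi> h $ i * ?g i (\<Psi> u)) = (\<Sum>i\<in>UNIV - {c}. h $ i * ?g i (\<Psi> u))"
        by (rule sum.cong) auto
      ultimately show "(D\<Psi> u \<circ> ?D\<Phi>) h = id h"
        using nz[OF \<Psi>W[OF u]] by (auto simp: vec_eq_iff D\<Psi>_def)
    qed
    show "continuous (at u) \<Psi>"
      using cont\<Psi> u unfolding continuous_on_eq_continuous_at[OF V] by blast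
  qed
  have part: "has_partial (\<lambda>u. \<Psi> u $ j) (D\<Psi> u (axis i 1) $ j) i u" if "u \<in> ?V" for i j u
  proof -
    have "((\<lambda>t. u + t *\<^sub>R axis i 1) has_derivative (\<lambda>t. t *\<^sub>R axis i 1)) (at 0)"
      by (auto intro!: derivative_eq_intros)
    moreover have "(\<Psi> has_derivative D\<Psi> u) (at (u + 0 *\<^sub>R axis i 1))"
      using der[OF that] by simp
    ultimately have "((\<lambda>t. \<Psi> (u + t *\<^sub>R axis i 1)) has_derivative (\<lambda>t. D\<Psi> u (t *\<^sub>R axis i 1))) (at 0)"
      by (rule has_derivative_compose)
    moreover have "D\<Psi> u (t *\<^sub>R axis i 1) = t *\<^sub>R D\<Psi> u (axis i 1)" for t
      using linear_scale[OF has_derivative_linear[OF der[OF that]]] .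
    ultimately have "((\<lambda>t. \<Psi> (u + t *\<^sub>R axis i 1)) has_derivative (\<lambda>t. t *\<^sub>R D\<Psi> u (axis i 1))) (at 0)"
      by simp
    from bounded_linear.has_derivative[OF bounded_linear_vec_nth this]
    show ?thesis
      unfolding has_partial_def has_field_derivative_def
      by (rule has_derivative_eq_rhs) (simp add: fun_eq_iff mult.commute)
  qed
  have D1: "D\<Psi> u (axis i 1) $ j = (if j = c then - 1 * (?g i (\<Psi> u) * inverse (?g c (\<Psi> u)))
      else if i = j then 1 else 0)" if "i \<noteq> c" for u i j
  proof -
    have "(\<Sum>m\<in>UNIV - {c}. axis i 1 $ m * ?g m (\<Psi> u)) = (\<Sum>m\<in>{i}. axis i 1 $ m * ?g m (\<Psi> u))"
      using that by (intro sum.mono_neutral_right) (auto simp: axis_def)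
    then show ?thesis
      using that by (auto simp: D\<Psi>_def axis_def)
  qed
  have D2: "D\<Psi> u (axis c 1) $ j = (if j = c then inverse (?g c (\<Psi> u)) else 0)" for u j
  proof -
    have "(\<Sum>m\<in>UNIV - {c}. axis c 1 $ m * ?g m (\<Psi> u)) = 0"
      by (intro sum.neutral) (auto simp: axis_def)
    then show ?thesis
      by (auto simp: D\<Psi>_def axis_def)
  qed
  have smooth: "C_on r ?V (\<lambda>u. \<Psi> u $ j)" for r j
  proof (induction r arbitrary: j)
    case 0
    show ?case using cont\<Psi> by (auto intro: continuous_intros)
  next
    case (Suc r)
    have g\<Psi>: "C_on r ?V (\<lambda>u. ?g i (\<Psi> u))" for i
      by (rule C_on_compose[OF V W(1) \<Psi>W Suc.IH C_on_partial_deriv[OF G]])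
    have inv: "C_on r ?V (\<lambda>u. inverse (?g c (\<Psi> u)))"
      by (rule C_on_inverse[OF V g\<Psi> nz[OF \<Psi>W]])
    show ?case
    proof (rule C_on_SucI[OF V _ part])
      show "C_on r ?V (\<lambda>u. D\<Psi> u (axis i 1) $ j)" for i
      proof (cases "i = c")
        case True
        then show ?thesis using inv by (cases "j = c") (auto simp: D2 C_on_const[OF V])
      next
        case False
        have "C_on r ?V (\<lambda>u. - 1 * (?g i (\<Psi> u) * inverse (?g c (\<Psi> u))))"
          by (intro C_on_mult C_on_const V inv g\<Psi>)
        then show ?thesis using False by (cases "j = c") (auto simp: D1 C_on_const[OF V])
      qed
    qed (use C_on_imp_continuous[OF Suc.IH] in auto)
  qed
  show thesis
  proof (rule that[OF V \<Psi>\<Phi> smooth])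
    show "has_partial (\<lambda>u. \<Psi> u $ j) (if j = c then - (?g i (\<Psi> u) / ?g c (\<Psi> u))
        else if i = j then 1 else 0) i u" if "u \<in> ?V" "i \<noteq> c" for i j u
      using part[OF that(1), of j i] D1[OF that(2), of u j]
      by (cases "j = c") (simp_all add: divide_inverse)
  qed
qed

section \<open>The system forces a superposition\<close>

text \<open>
  Cubes serve as neighbourhoods because, unlike general convex sets, they contain with \<open>x\<close> also
  every point that arises from \<open>x\<close> by resetting coordinates to those of the centre \<open>p\<close>.
\<close>

definition cube :: "real^'n::finite \<Rightarrow> real \<Rightarrow> (real^'n) set" where
  "cube p \<delta> = box (\<chi> i. p $ i - \<delta>) (\<chi> i. p $ i + \<delta>)"

lemma mem_cube: "x \<in> cube p \<delta> \<longleftrightarrow> (\<forall>i. \<bar>x $ i - p $ i\<bar> < \<delta>)"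
  unfolding cube_def mem_box_cart by (auto simp: abs_less_iff algebra_simps)

lemma open_cube: "open (cube p \<delta>)" and convex_cube: "convex (cube p \<delta>)"
  unfolding cube_def by (auto intro: open_box convex_box)

lemma eventually_cube:
  fixes p :: "real^'n::finite"
  assumes "eventually Q (nhds p)"
  obtains \<delta> where "\<delta> > 0" "\<And>x. x \<in> cube p \<delta> \<Longrightarrow> Q x"
proof -
  obtain \<epsilon> where \<epsilon>: "\<epsilon> > 0" "\<And>x. dist x p < \<epsilon> \<Longrightarrow> Q x"
    using assms unfolding eventually_nhds_metric by auto
  show thesis
  proof (rule that)
    show "\<epsilon> / CARD('n) > 0" using \<epsilon>(1) by simp
    fix x assume x: "x \<in> cube p (\<epsilon> / CARD('n))"
    have "norm (x - p) \<le> (\<Sum>i\<in>UNIV. \<bar>(x - p) $ i\<bar>)"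
      by (rule norm_le_l1_cart)
    also have "\<dots> < (\<Sum>i\<in>(UNIV::'n set). \<epsilon> / CARD('n))"
      using x by (intro sum_strict_mono) (auto simp: mem_cube)
    finally show "Q x"
      by (intro \<epsilon>(2)) (simp add: dist_norm)
  qed
qed

lemma smooth_near_compose:
  assumes F: "smooth_near F (\<phi> p)" and \<phi>: "\<And>r j. C_on r UNIV (\<lambda>x. \<phi> x $ j)"
  shows "smooth_near (\<lambda>x. F (\<phi> x)) p"
proof -
  obtain U where U: "open U" "\<phi> p \<in> U" "\<And>r. C_on r U F"
    using F unfolding smooth_near_def by auto
  have "continuous_on UNIV \<phi>"
    by (intro continuous_on_vecI C_on_imp_continuous[OF \<phi>])
  then have V: "open (\<phi> -` U)"
    by (rule open_vimage[OF U(1)])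
  have "C_on r (\<phi> -` U) (\<lambda>x. F (\<phi> x))" for r
    by (rule C_on_compose[OF V U(1) _ C_on_subset[OF \<phi>] U(3)]) auto
  with U V show ?thesis
    unfolding smooth_near_def by (intro exI[of _ "\<phi> -` U"]) auto
qed

lemma C_on_if: "(b \<Longrightarrow> C_on r U f) \<Longrightarrow> (\<not> b \<Longrightarrow> C_on r U g) \<Longrightarrow> C_on r U (\<lambda>x. if b then f x else g x)"
  by (cases b) simp_all

text \<open>
  Freezing the variables in \<open>L\<close> at the base point gives \<open>G x = F (\<pi> x)\<close>. The equations state that
  the ratios \<open>F\<^sub>a / F\<^sub>c\<close> have vanishing derivatives in the directions of \<open>L\<close>, whence they agree
  with \<open>G\<^sub>a / G\<^sub>c\<close>: in the variables of \<open>A\<close> the gradients of \<open>F\<close> and \<open>G\<close> are parallel. After \<open>G\<close>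
  has replaced \<open>x\<^sub>c\<close> as a coordinate, \<open>F\<close> becomes a function \<open>K\<close> whose derivatives in the
  remaining directions of \<open>A\<close> vanish, so these variables can be frozen at the base point too.
\<close>

lemma system_imp_superposition:
  fixes F :: "real^'n::finite \<Rightarrow> real" and c :: 'n
  assumes F: "smooth_near F P" and c: "c \<in> A" and LA: "L \<inter> A = {}"
    and nz: "\<forall>\<^sub>F x in nhds P. partial_deriv c F x \<noteq> 0"
    and pde: "\<forall>\<^sub>F x in nhds P. \<forall>p\<in>L. \<forall>a\<in>A.
      partial_deriv p (partial_deriv a F) x * partial_deriv c F x =
      partial_deriv p (partial_deriv c F) x * partial_deriv a F x"
  defines "\<pi> \<equiv> \<lambda>x. \<chi> i. if i \<in> L then P $ i else x $ i"
  obtains K where "smooth_near K (replace_coord c (F P) P)"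
    and "\<forall>\<^sub>F x in nhds P. F x = K (\<chi> i. if i = c then F (\<pi> x) else if i \<in> A then P $ i else x $ i)"
proof -
  obtain U where U: "open U" "P \<in> U" "\<And>r. C_on r U F"
    using F unfolding smooth_near_def by auto
  have "\<forall>\<^sub>F x in nhds P. x \<in> U \<and> partial_deriv c F x \<noteq> 0 \<and> (\<forall>p\<in>L. \<forall>a\<in>A.
      partial_deriv p (partial_deriv a F) x * partial_deriv c F x =
      partial_deriv p (partial_deriv c F) x * partial_deriv a F x)"
    using eventually_nhds_in_open[OF U(1,2)] nz pde by eventually_elim auto
  then obtain \<delta> where "\<delta> > 0" and \<delta>: "\<And>x. x \<in> cube P \<delta> \<Longrightarrow> x \<in> U"
    "\<And>x. x \<in> cube P \<delta> \<Longrightarrow> partial_deriv c F x \<noteq> 0"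
    "\<And>x p a. x \<in> cube P \<delta> \<Longrightarrow> p \<in> L \<Longrightarrow> a \<in> A \<Longrightarrow>
      partial_deriv p (partial_deriv a F) x * partial_deriv c F x =
      partial_deriv p (partial_deriv c F) x * partial_deriv a F x"
    by (rule eventually_cube) blast
  define W where "W = cube P \<delta>"
  note W = open_cube[of P \<delta>, folded W_def] convex_cube[of P \<delta>, folded W_def]
  note \<delta> = \<delta>[folded W_def]
  have FW: "C_on r W F" for r
    by (rule C_on_subset[OF U(3)]) (use \<delta>(1) in auto)
  have PW: "P \<in> W"
    using \<open>\<delta> > 0\<close> by (simp add: W_def mem_cube)
  have \<pi>W: "\<pi> x \<in> W" if "x \<in> W" for x
    using that \<open>\<delta> > 0\<close> by (auto simp: W_def mem_cube \<pi>_def)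
  have \<pi>P: "\<pi> P = P"
    by (simp add: \<pi>_def vec_eq_iff)
  define G where "G x = F (\<pi> x)" for x
  have G: "C_on r W G" for r
    unfolding G_def
    by (rule C_on_compose[OF W(1) W(1) \<pi>W _ FW])
       (auto simp: \<pi>_def intro!: C_on_if C_on_const C_on_coord W(1))
  have G_partial: "partial_deriv a G x = partial_deriv a F (\<pi> x)" if "a \<in> A" for a x
  proof -
    have "\<pi> (x + t *\<^sub>R axis a 1) = \<pi> x + t *\<^sub>R axis a 1" for t
      using that LA by (auto simp: \<pi>_def vec_eq_iff axis_def)
    then show ?thesis
      by (simp add: partial_deriv_def G_def)
  qed
  \<comment> \<open>Both sides are values of one function at \<open>x\<close> and \<open>\<pi> x\<close>, which differ only in coordinates of \<open>L\<close>.\<close>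
  have ratio: "partial_deriv a F x * inverse (partial_deriv c F x) =
      partial_deriv a F (\<pi> x) * inverse (partial_deriv c F (\<pi> x))" if x: "x \<in> W" and a: "a \<in> A" for a x
  proof (rule eq_if_partials_vanish[OF W _ x \<pi>W[OF x]])
    show "C_on (Suc 0) W (\<lambda>x. partial_deriv a F x * inverse (partial_deriv c F x))"
      by (intro C_on_mult C_on_inverse W(1) C_on_partial_deriv[OF FW] \<delta>(2))
    fix p z assume z: "z \<in> W" and "x $ p \<noteq> \<pi> x $ p"
    then have p: "p \<in> L"
      by (auto simp: \<pi>_def split: if_splits)
    have "has_partial (\<lambda>x. partial_deriv a F x * inverse (partial_deriv c F x))
      (partial_deriv p (partial_deriv a F) z * inverse (partial_deriv c F z) +
       partial_deriv a F z * (- (inverse (partial_deriv c F z) *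
         partial_deriv p (partial_deriv c F) z * inverse (partial_deriv c F z)))) p z"
      by (intro has_partial_mult has_partial_inverse \<delta>(2) z
          C_on_has_partial[OF C_on_partial_deriv[OF FW] z])
    moreover have "partial_deriv p (partial_deriv a F) z * inverse (partial_deriv c F z) +
       partial_deriv a F z * (- (inverse (partial_deriv c F z) *
         partial_deriv p (partial_deriv c F) z * inverse (partial_deriv c F z))) = 0"
      using \<delta>(3)[OF z p a] \<delta>(2)[OF z] by (simp add: field_simps)
    ultimately show "partial_deriv p (\<lambda>x. partial_deriv a F x * inverse (partial_deriv c F x)) z = 0"
      using has_partial_imp_partial_deriv by metis
  qed
  have G_c: "partial_deriv c G x \<noteq> 0" if "x \<in> W" for x
    using \<delta>(2)[OF \<pi>W[OF that]] by (simp add: G_partial[OF c])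
  define \<Phi> where "\<Phi> x = replace_coord c (G x) x" for x
  define V where "V = \<Phi> ` W"
  obtain \<Psi> where V: "open V"
    and \<Psi>\<Phi>: "\<And>x. x \<in> W \<Longrightarrow> \<Psi> (\<Phi> x) = x"
    and \<Psi>: "\<And>r j. C_on r V (\<lambda>u. \<Psi> u $ j)"
    and \<Psi>_partial: "\<And>i j u. u \<in> V \<Longrightarrow> i \<noteq> c \<Longrightarrow> has_partial (\<lambda>u. \<Psi> u $ j)
      (if j = c then - (partial_deriv i G (\<Psi> u) / partial_deriv c G (\<Psi> u))
       else if i = j then 1 else 0) i u"
    by (rule smooth_local_inverse[OF W G G_c, folded \<Phi>_def, folded V_def]) blast+
  have \<Psi>W: "\<Psi> u \<in> W" if "u \<in> V" for u
    using that \<Psi>\<Phi> by (auto simp: V_def)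
  have \<Phi>P: "\<Phi> P = replace_coord c (F P) P"
    by (simp add: \<Phi>_def G_def \<pi>P)
  define K where "K u = F (\<Psi> u)" for u
  have K: "C_on r V K" for r
    unfolding K_def by (rule C_on_compose[OF V W(1) \<Psi>W \<Psi> FW])
  have K_partial: "partial_deriv a K u = 0" if u: "u \<in> V" and a: "a \<in> A" "a \<noteq> c" for a u
  proof -
    let ?D = "\<lambda>j. if j = c then - (partial_deriv a G (\<Psi> u) / partial_deriv c G (\<Psi> u))
       else if a = j then 1 else 0"
    have "has_partial K (\<Sum>j\<in>UNIV. ?D j * partial_deriv j F (\<Psi> u)) a u"
      unfolding K_def
      by (rule has_partial_compose[OF W(1) FW \<Psi>W[OF u] \<Psi>_partial[OF u a(2)]])
    \<comment> \<open>Only the new coordinate \<open>c\<close> and \<open>a\<close> itself contribute: \<open>F\<^sub>a - F\<^sub>c G\<^sub>a / G\<^sub>c = 0\<close>.\<close>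
    moreover have "(\<Sum>j\<in>UNIV. ?D j * partial_deriv j F (\<Psi> u)) =
        (\<Sum>j\<in>{a, c}. ?D j * partial_deriv j F (\<Psi> u))"
      by (rule sum.mono_neutral_right) auto
    moreover have "\<dots> = 0"
      using ratio[OF \<Psi>W[OF u] a(1)] a \<delta>(2)[OF \<Psi>W[OF u]] \<delta>(2)[OF \<pi>W[OF \<Psi>W[OF u]]]
      by (simp add: G_partial c field_simps)
    ultimately show ?thesis
      using has_partial_imp_partial_deriv by metis
  qed
  have \<Phi>PV: "\<Phi> P \<in> V"
    using PW by (simp add: V_def)
  obtain \<eta> where "\<eta> > 0" and \<eta>: "\<And>u. u \<in> cube (\<Phi> P) \<eta> \<Longrightarrow> u \<in> V"
    using eventually_nhds_in_open[OF V \<Phi>PV] by (rule eventually_cube) blast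
  show thesis
  proof (rule that)
    show "smooth_near K (replace_coord c (F P) P)"
      unfolding smooth_near_def \<Phi>P[symmetric] using V \<Phi>PV K by blast
    have cont: "isCont \<Phi> P"
    proof -
      have "continuous_on W \<Phi>"
      proof (rule continuous_on_vecI)
        show "continuous_on W (\<lambda>x. \<Phi> x $ j)" for j
          using C_on_imp_continuous[OF G]
          by (cases "j = c") (auto simp: \<Phi>_def intro!: continuous_intros)
      qed
      then show ?thesis using W(1) PW by (simp add: continuous_on_eq_continuous_at)
    qed
    have "\<forall>\<^sub>F x in nhds P. \<Phi> x \<in> cube (\<Phi> P) \<eta>"
      using cont \<open>\<eta> > 0\<close> unfolding isCont_def tendsto_at_iff_tendsto_nhds
      by (rule_tac topological_tendstoD) (auto simp: open_cube mem_cube)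
    moreover have "\<forall>\<^sub>F x in nhds P. x \<in> W"
      by (rule eventually_nhds_in_open[OF W(1) PW])
    ultimately show "\<forall>\<^sub>F x in nhds P. F x =
        K (\<chi> i. if i = c then F (\<pi> x) else if i \<in> A then P $ i else x $ i)"
    proof eventually_elim
      fix x assume x: "\<Phi> x \<in> cube (\<Phi> P) \<eta>" "x \<in> W"
      let ?\<zeta> = "\<chi> i. if i = c then F (\<pi> x) else if i \<in> A then P $ i else x $ i"
      have "\<bar>?\<zeta> $ i - \<Phi> P $ i\<bar> < \<eta>" for i
        using x(1) \<open>\<eta> > 0\<close> unfolding mem_cube
        by (auto simp: \<Phi>_def G_def dest: spec[of _ i])
      then have \<zeta>: "?\<zeta> \<in> cube (\<Phi> P) \<eta>"
        unfolding mem_cube by blast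
      have "K (\<Phi> x) = K ?\<zeta>"
      proof (rule eq_if_partials_vanish[OF open_cube convex_cube _ x(1) \<zeta>])
        show "C_on (Suc 0) (cube (\<Phi> P) \<eta>) K"
          by (rule C_on_subset[OF K]) (use \<eta> in auto)
        fix i z assume "z \<in> cube (\<Phi> P) \<eta>" "\<Phi> x $ i \<noteq> ?\<zeta> $ i"
        then show "partial_deriv i K z = 0"
          by (intro K_partial \<eta>) (auto simp: \<Phi>_def G_def split: if_splits)
      qed
      then show "F x = K ?\<zeta>"
        using \<Psi>\<Phi>[OF x(2)] by (simp add: K_def)
    qed
  qed
qed

section \<open>A superposition solves the system\<close>

text \<open>
  Moving along an axis of \<open>A\<close> changes only the argument \<open>\<tau>\<close> of \<open>f\<close>, so \<open>F\<^sub>a\<close> is the product of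
  \<open>f\<^sub>\<tau>\<close> and \<open>g\<^sub>\<sigma>\<^sub>a\<close>. The second factor does not depend on the variables of \<open>L\<close>, whence
  \<open>F\<^sub>p\<^sub>a\<close> is the product of \<open>f\<^sub>\<tau>\<^sub>\<rho>\<^sub>p\<close> and \<open>g\<^sub>\<sigma>\<^sub>a\<close>, and the equation becomes symmetric
  in \<open>a\<close> and \<open>b\<close>. Every differentiation is along one axis of the arguments of \<open>f\<close> or \<open>g\<close>, so the
  one-variable chain rule suffices. Only this behaviour of the argument maps \<open>\<kappa>\<close> and \<open>\<omega>\<close> is
  assumed, which separates the calculus from the numbering of variables.
\<close>

lemma superposition_imp_system:
  fixes F :: "real^'n::finite \<Rightarrow> real" and f :: "real^'m::finite \<Rightarrow> real" and g :: "real^'j::finite \<Rightarrow> real"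
    and \<kappa> :: "real^'n \<Rightarrow> real^'j" and \<omega> :: "real \<Rightarrow> real^'n \<Rightarrow> real^'m"
  assumes g: "smooth_near g (\<kappa> P)" and f: "smooth_near f (\<omega> (g (\<kappa> P)) P)"
    and F: "\<forall>\<^sub>F x in nhds P. F x = f (\<omega> (g (\<kappa> x)) x)"
    and \<kappa>: "continuous_on UNIV \<kappa>" and \<omega>: "continuous_on UNIV (\<lambda>(s, x). \<omega> s x)"
    and \<omega>_s: "\<And>s t x. \<omega> t x = \<omega> s x + (t - s) *\<^sub>R axis \<tau> 1"
    and \<kappa>_A: "\<And>a t x. a \<in> A \<Longrightarrow> \<kappa> (x + t *\<^sub>R axis a 1) = \<kappa> x + t *\<^sub>R axis (\<sigma> a) 1"
    and \<omega>_A: "\<And>a s t x. a \<in> A \<Longrightarrow> \<omega> s (x + t *\<^sub>R axis a 1) = \<omega> s x"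
    and \<kappa>_L: "\<And>p t x. p \<in> L \<Longrightarrow> \<kappa> (x + t *\<^sub>R axis p 1) = \<kappa> x"
    and \<omega>_L: "\<And>p s t x. p \<in> L \<Longrightarrow> \<omega> s (x + t *\<^sub>R axis p 1) = \<omega> s x + t *\<^sub>R axis (\<rho> p) 1"
  shows "\<forall>\<^sub>F x in nhds P. \<forall>p\<in>L. \<forall>a\<in>A. \<forall>b\<in>A.
      partial_deriv p (partial_deriv a F) x * partial_deriv b F x =
      partial_deriv p (partial_deriv b F) x * partial_deriv a F x"
proof -
  define \<Omega> where "\<Omega> x = \<omega> (g (\<kappa> x)) x" for x
  obtain Ug where Ug: "open Ug" "\<kappa> P \<in> Ug" "\<And>r. C_on r Ug g"
    using g unfolding smooth_near_def by auto
  obtain Uf where Uf: "open Uf" "\<Omega> P \<in> Uf" "\<And>r. C_on r Uf f"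
    using f unfolding smooth_near_def \<Omega>_def by auto
  have "open (\<kappa> -` Ug)"
    by (rule open_vimage[OF Ug(1) \<kappa>])
  moreover have "continuous_on (\<kappa> -` Ug) \<Omega>"
  proof -
    have "continuous_on (\<kappa> -` Ug) (\<lambda>x. (g (\<kappa> x), x))"
      by (intro continuous_intros continuous_on_compose2[OF C_on_imp_continuous[OF Ug(3)]]
          continuous_on_subset[OF \<kappa>]) auto
    from continuous_on_compose2[OF \<omega> this] show ?thesis
      by (simp add: \<Omega>_def[abs_def])
  qed
  ultimately have "open (\<kappa> -` Ug \<inter> \<Omega> -` Uf)"
    using Uf(1) by (metis continuous_open_preimage)
  then have "\<forall>\<^sub>F x in nhds P. x \<in> \<kappa> -` Ug \<inter> \<Omega> -` Uf"
    using Ug Uf by (intro eventually_nhds_in_open) auto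
  with F have "\<forall>\<^sub>F x in nhds P. \<kappa> x \<in> Ug \<and> \<Omega> x \<in> Uf \<and> F x = f (\<Omega> x)"
    by eventually_elim (auto simp: \<Omega>_def)
  then obtain S where S: "open S" "P \<in> S"
    "\<And>x. x \<in> S \<Longrightarrow> \<kappa> x \<in> Ug" "\<And>x. x \<in> S \<Longrightarrow> \<Omega> x \<in> Uf" "\<And>x. x \<in> S \<Longrightarrow> F x = f (\<Omega> x)"
    unfolding eventually_nhds by blast
  have F_A: "partial_deriv a F x = partial_deriv \<tau> f (\<Omega> x) * partial_deriv (\<sigma> a) g (\<kappa> x)"
    if x: "x \<in> S" and a: "a \<in> A" for a x
  proof -
    have "((\<lambda>t. g (\<kappa> x + t *\<^sub>R axis (\<sigma> a) 1) - g (\<kappa> x)) has_real_derivative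
        partial_deriv (\<sigma> a) g (\<kappa> x)) (at 0)"
      using C_on_has_partial[OF Ug(3) S(3)[OF x]] unfolding has_partial_def
      by (auto intro!: derivative_eq_intros)
    moreover have "((\<lambda>s. f (\<Omega> x + s *\<^sub>R axis \<tau> 1)) has_real_derivative partial_deriv \<tau> f (\<Omega> x))
        (at (g (\<kappa> x + 0 *\<^sub>R axis (\<sigma> a) 1) - g (\<kappa> x)))"
      using C_on_has_partial[OF Uf(3) S(4)[OF x]] unfolding has_partial_def by simp
    ultimately have "((\<lambda>t. f (\<Omega> x + (g (\<kappa> x + t *\<^sub>R axis (\<sigma> a) 1) - g (\<kappa> x)) *\<^sub>R axis \<tau> 1))
        has_real_derivative partial_deriv \<tau> f (\<Omega> x) * partial_deriv (\<sigma> a) g (\<kappa> x)) (at 0)"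
      by (rule DERIV_chain2[rotated])
    moreover have "\<Omega> (x + t *\<^sub>R axis a 1) =
        \<Omega> x + (g (\<kappa> x + t *\<^sub>R axis (\<sigma> a) 1) - g (\<kappa> x)) *\<^sub>R axis \<tau> 1" for t
      unfolding \<Omega>_def \<kappa>_A[OF a] \<omega>_A[OF a] by (rule \<omega>_s)
    ultimately have "has_partial (\<lambda>x. f (\<Omega> x))
        (partial_deriv \<tau> f (\<Omega> x) * partial_deriv (\<sigma> a) g (\<kappa> x)) a x"
      by (simp add: has_partial_def)
    then have "has_partial F (partial_deriv \<tau> f (\<Omega> x) * partial_deriv (\<sigma> a) g (\<kappa> x)) a x"
      by (subst has_partial_cong[where g = "\<lambda>x. f (\<Omega> x)", OF S(1) x S(5)])
    then show ?thesis
      by (rule has_partial_imp_partial_deriv)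
  qed
  have F_LA: "partial_deriv p (partial_deriv a F) x =
      partial_deriv (\<rho> p) (partial_deriv \<tau> f) (\<Omega> x) * partial_deriv (\<sigma> a) g (\<kappa> x)"
    if x: "x \<in> S" and p: "p \<in> L" and a: "a \<in> A" for p a x
  proof -
    have "((\<lambda>t. partial_deriv \<tau> f (\<Omega> x + t *\<^sub>R axis (\<rho> p) 1)) has_real_derivative
        partial_deriv (\<rho> p) (partial_deriv \<tau> f) (\<Omega> x)) (at 0)"
      using C_on_has_partial[OF C_on_partial_deriv[OF Uf(3)] S(4)[OF x]] unfolding has_partial_def .
    moreover have "\<Omega> (x + t *\<^sub>R axis p 1) = \<Omega> x + t *\<^sub>R axis (\<rho> p) 1" for t
      unfolding \<Omega>_def \<kappa>_L[OF p] by (rule \<omega>_L[OF p])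
    ultimately have "has_partial (\<lambda>x. partial_deriv \<tau> f (\<Omega> x) * partial_deriv (\<sigma> a) g (\<kappa> x))
      (partial_deriv (\<rho> p) (partial_deriv \<tau> f) (\<Omega> x) * partial_deriv (\<sigma> a) g (\<kappa> x)) p x"
      by (simp add: has_partial_def \<kappa>_L[OF p] DERIV_cmult_right)
    then have "has_partial (partial_deriv a F)
      (partial_deriv (\<rho> p) (partial_deriv \<tau> f) (\<Omega> x) * partial_deriv (\<sigma> a) g (\<kappa> x)) p x"
      by (subst has_partial_cong[where g = "\<lambda>x. partial_deriv \<tau> f (\<Omega> x) * partial_deriv (\<sigma> a) g (\<kappa> x)",
            OF S(1) x F_A[OF _ a]])
    then show ?thesis
      by (rule has_partial_imp_partial_deriv)
  qed
  show ?thesis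
    using eventually_nhds_in_open[OF S(1,2)]
    by eventually_elim (simp add: F_A F_LA mult_ac)
qed

section \<open>The numbered variables\<close>

lemma vec_eq_by_numbering:
  assumes "bij_betw e {1..d} (UNIV :: 'i::finite set)"
    and "\<And>j. j \<in> {1..d} \<Longrightarrow> u $ e j = v $ e j"
  shows "u = (v :: real^'i)"
proof -
  have "u $ i = v $ i" for i
    using assms by (metis UNIV_I bij_betw_imp_surj_on imageE)
  then show ?thesis by (simp add: vec_eq_iff)
qed

lemma inner_args_nth:
  assumes "bij_betw e' {1..n - l} UNIV" "j \<in> {1..n - l}"
  shows "inner_args e e' n l x $ e' j = x $ e (l + j)"
  unfolding inner_args_def using point_of_nth[OF assms] by simp

lemma outer_args_nth:
  assumes "bij_betw e' {1..n - k + l + 1} UNIV" "j \<in> {1..n - k + l + 1}"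
  shows "outer_args e e' n k l t x $ e' j =
    (if j \<le> l then x $ e j else if j = l + 1 then t else x $ e (k + (j - (l + 1))))"
  unfolding outer_args_def using point_of_nth[OF assms] by simp

lemma continuous_on_inner_args: "continuous_on UNIV (inner_args e e' n l)"
  by (rule continuous_on_vecI) (auto simp: inner_args_def point_of_def intro!: continuous_intros)

lemma continuous_on_outer_args: "continuous_on UNIV (\<lambda>(t, x). outer_args e e' n k l t x)"
proof (rule continuous_on_vecI)
  fix i
  let ?j = "inv_into {1..n - k + l + 1} e' i"
  consider "?j \<le> l" | "?j = l + 1" | "?j > l + 1" by linarith
  then show "continuous_on UNIV (\<lambda>z. (case z of (t, x) \<Rightarrow> outer_args e e' n k l t x) $ i)"
    by cases (auto simp: outer_args_def point_of_def split_beta intro!: continuous_intros)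
qed

theorem mainTheorem2:
  fixes n k l :: nat
    and F :: "real^'n::finite \<Rightarrow> real"
    and P :: "real^'n"
    and e :: "nat \<Rightarrow> 'n"
    and e\<^sub>f :: "nat \<Rightarrow> 'm::finite"
    and e\<^sub>g :: "nat \<Rightarrow> 'j::finite"
  assumes "1 < k" and "k < n" and "1 \<le> l" and "l < k"
    and "bij_betw e {1..n} (UNIV :: 'n set)"
    and "bij_betw e\<^sub>f {1..n - k + l + 1} (UNIV :: 'm set)"
    and "bij_betw e\<^sub>g {1..n - l} (UNIV :: 'j set)"
    and "smooth_near F P"
    and "\<forall>\<^sub>F x in nhds P. \<forall>\<alpha>\<in>{1..n}. partial_deriv (e \<alpha>) F x \<noteq> 0"
  shows "(\<forall>\<^sub>F x in nhds P. \<forall>p\<in>{1..l}. \<forall>a\<in>{l+1..k}. \<forall>b\<in>{l+1..k}.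
            partial_deriv (e p) (partial_deriv (e a) F) x * partial_deriv (e b) F x =
            partial_deriv (e p) (partial_deriv (e b) F) x * partial_deriv (e a) F x)
         \<longleftrightarrow>
         (\<exists>(f :: real^'m \<Rightarrow> real) (g :: real^'j \<Rightarrow> real).
            smooth_near g (inner_args e e\<^sub>g n l P) \<and>
            smooth_near f (outer_args e e\<^sub>f n k l (g (inner_args e e\<^sub>g n l P)) P) \<and>
            (\<forall>\<^sub>F x in nhds P.
               F x = f (outer_args e e\<^sub>f n k l (g (inner_args e e\<^sub>g n l x)) x)))"
  (is "?system \<longleftrightarrow> ?superposition")
proof -
  note kln = assms(1-4) and e = assms(5) and e_f = assms(6) and e_g = assms(7)
  define \<nu> where "\<nu> = inv_into {1..n} e"
  have \<nu>e: "\<nu> (e j) = j" if "j \<in> {1..n}" for j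
    using that e by (simp add: \<nu>_def bij_betw_def)
  have e\<nu>: "e (\<nu> i) = i" and \<nu>n: "\<nu> i \<in> {1..n}" for i
    using e unfolding \<nu>_def by (metis UNIV_I bij_betw_inv_into_right, metis UNIV_I bij_betw_imp_surj_on inv_into_into)
  have e_eq: "e a = e b \<longleftrightarrow> a = b" if "a \<in> {1..n}" "b \<in> {1..n}" for a b
    using that \<nu>e by metis
  have e_f_eq: "e\<^sub>f a = e\<^sub>f b \<longleftrightarrow> a = b" if "a \<in> {1..n - k + l + 1}" "b \<in> {1..n - k + l + 1}" for a b
    by (rule inj_on_eq_iff[OF bij_betw_imp_inj_on[OF e_f] that])
  have e_g_eq: "e\<^sub>g a = e\<^sub>g b \<longleftrightarrow> a = b" if "a \<in> {1..n - l}" "b \<in> {1..n - l}" for a b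
    by (rule inj_on_eq_iff[OF bij_betw_imp_inj_on[OF e_g] that])
  define L A c where "L = e ` {1..l}" and "A = e ` {l+1..k}" and "c = e (l + 1)"
  have L_iff: "i \<in> L \<longleftrightarrow> \<nu> i \<le> l" for i
  proof
    assume "i \<in> L" then show "\<nu> i \<le> l" using \<nu>e kln by (auto simp: L_def)
  next
    assume "\<nu> i \<le> l" then show "i \<in> L"
      using e\<nu>[of i] \<nu>n[of i] by (auto simp: L_def intro!: image_eqI[of _ _ "\<nu> i"])
  qed
  have A_iff: "i \<in> A \<longleftrightarrow> l < \<nu> i \<and> \<nu> i \<le> k" for i
  proof
    assume "i \<in> A" then show "l < \<nu> i \<and> \<nu> i \<le> k" using \<nu>e kln by (auto simp: A_def)
  next
    assume "l < \<nu> i \<and> \<nu> i \<le> k" then show "i \<in> A"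
      using e\<nu>[of i] \<nu>n[of i] by (auto simp: A_def intro!: image_eqI[of _ _ "\<nu> i"])
  qed
  have cA: "c \<in> A" and LA: "L \<inter> A = {}"
    using kln by (auto simp: c_def A_def L_iff A_iff \<nu>e)
  let ?\<kappa> = "inner_args e e\<^sub>g n l"
  let ?\<omega> = "outer_args e e\<^sub>f n k l"
  let ?pde = "\<lambda>p a b x. partial_deriv p (partial_deriv a F) x * partial_deriv b F x =
      partial_deriv p (partial_deriv b F) x * partial_deriv a F x"
  have system: "?system \<longleftrightarrow> (\<forall>\<^sub>F x in nhds P. \<forall>p\<in>L. \<forall>a\<in>A. \<forall>b\<in>A. ?pde p a b x)"
    by (simp add: L_def A_def)
  show ?thesis
    unfolding system
  proof
    assume "\<forall>\<^sub>F x in nhds P. \<forall>p\<in>L. \<forall>a\<in>A. \<forall>b\<in>A. ?pde p a b x"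
    then have pde: "\<forall>\<^sub>F x in nhds P. \<forall>p\<in>L. \<forall>a\<in>A. ?pde p a c x"
      by eventually_elim (use cA in blast)
    have nz: "\<forall>\<^sub>F x in nhds P. partial_deriv c F x \<noteq> 0"
      using assms(9) by eventually_elim (use kln in \<open>auto simp: c_def\<close>)
    define \<pi> where "\<pi> x = (\<chi> i. if i \<in> L then P $ i else x $ i)" for x :: "real^'n"
    obtain K where K: "smooth_near K (replace_coord c (F P) P)"
      and FK: "\<forall>\<^sub>F x in nhds P. F x = K (\<chi> i. if i = c then F (\<pi> x) else if i \<in> A then P $ i else x $ i)"
      by (rule system_imp_superposition[OF assms(8) cA LA nz pde, folded \<pi>_def])
    \<comment> \<open>\<open>\<iota>\<^sub>g\<close> and \<open>\<iota>\<^sub>f\<close> put the arguments of \<open>g\<close> and \<open>f\<close> back in place, with base point values in the gaps.\<close>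
    define \<iota>\<^sub>g :: "real^'j \<Rightarrow> real^'n" where
      "\<iota>\<^sub>g v = (\<chi> i. if i \<in> L then P $ i else v $ e\<^sub>g (\<nu> i - l))" for v
    define \<iota>\<^sub>f :: "real^'m \<Rightarrow> real^'n" where
      "\<iota>\<^sub>f v = (\<chi> i. if i = c then v $ e\<^sub>f (l + 1) else if i \<in> A then P $ i
        else if i \<in> L then v $ e\<^sub>f (\<nu> i) else v $ e\<^sub>f (\<nu> i - k + l + 1))" for v
    have \<iota>\<^sub>g: "\<iota>\<^sub>g (?\<kappa> x) = \<pi> x" for x
    proof -
      have "?\<kappa> x $ e\<^sub>g (\<nu> i - l) = x $ i" if "i \<notin> L" for i
        using that \<nu>n[of i] by (subst inner_args_nth[OF e_g]) (auto simp: L_iff e\<nu>)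
      then show ?thesis by (simp add: \<iota>\<^sub>g_def \<pi>_def vec_eq_iff)
    qed
    have \<iota>\<^sub>f: "\<iota>\<^sub>f (?\<omega> t x) = (\<chi> i. if i = c then t else if i \<in> A then P $ i else x $ i)" for t x
    proof -
      have "?\<omega> t x $ e\<^sub>f (l + 1) = t"
        by (subst outer_args_nth[OF e_f]) auto
      moreover have "?\<omega> t x $ e\<^sub>f (\<nu> i) = x $ i" if "i \<in> L" for i
        using that \<nu>n[of i] by (subst outer_args_nth[OF e_f]) (auto simp: L_iff e\<nu>)
      moreover have "?\<omega> t x $ e\<^sub>f (\<nu> i - k + l + 1) = x $ i" if "i \<notin> A" "i \<notin> L" for i
        using that \<nu>n[of i] by (subst outer_args_nth[OF e_f]) (auto simp: L_iff A_iff e\<nu>)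
      ultimately show ?thesis by (simp add: \<iota>\<^sub>f_def vec_eq_iff)
    qed
    have \<pi>P: "\<pi> P = P" by (simp add: \<pi>_def vec_eq_iff)
    have \<iota>\<^sub>fP: "\<iota>\<^sub>f (?\<omega> (F P) P) = replace_coord c (F P) P"
      by (simp add: \<iota>\<^sub>f vec_eq_iff)
    have "smooth_near (\<lambda>v. F (\<iota>\<^sub>g v)) (?\<kappa> P)"
    proof (rule smooth_near_compose)
      show "C_on r UNIV (\<lambda>v. \<iota>\<^sub>g v $ i)" for r i
        unfolding \<iota>\<^sub>g_def vec_lambda_beta by (intro C_on_if C_on_const C_on_coord open_UNIV)
    qed (simp add: \<iota>\<^sub>g \<pi>P assms(8))
    moreover have "smooth_near (\<lambda>v. K (\<iota>\<^sub>f v)) (?\<omega> (F P) P)"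
    proof (rule smooth_near_compose)
      show "C_on r UNIV (\<lambda>v. \<iota>\<^sub>f v $ i)" for r i
        unfolding \<iota>\<^sub>f_def vec_lambda_beta by (intro C_on_if C_on_const C_on_coord open_UNIV)
    qed (simp add: \<iota>\<^sub>fP K)
    ultimately show ?superposition
      using FK by (intro exI[of _ "\<lambda>v. K (\<iota>\<^sub>f v)"] exI[of _ "\<lambda>v. F (\<iota>\<^sub>g v)"]) (simp add: \<iota>\<^sub>g \<iota>\<^sub>f \<pi>P)
  next
    assume ?superposition
    then obtain f g where g: "smooth_near g (?\<kappa> P)" and f: "smooth_near f (?\<omega> (g (?\<kappa> P)) P)"
      and F: "\<forall>\<^sub>F x in nhds P. F x = f (?\<omega> (g (?\<kappa> x)) x)"
      by blast
    have tail: "e (k + (j - (l + 1))) \<noteq> e m"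
      if "j \<in> {1..n - k + l + 1}" "l + 1 < j" "m \<in> {1..k}" for j m
      using that kln by (subst e_eq) auto
    show "\<forall>\<^sub>F x in nhds P. \<forall>p\<in>L. \<forall>a\<in>A. \<forall>b\<in>A. ?pde p a b x"
    proof (rule superposition_imp_system[where \<kappa> = ?\<kappa> and \<omega> = ?\<omega> and \<tau> = "e\<^sub>f (l + 1)"
          and \<sigma> = "\<lambda>a. e\<^sub>g (\<nu> a - l)" and \<rho> = "\<lambda>p. e\<^sub>f (\<nu> p)",
          OF g f F continuous_on_inner_args continuous_on_outer_args])
      show "?\<omega> t x = ?\<omega> s x + (t - s) *\<^sub>R axis (e\<^sub>f (l + 1)) 1" for s t x
        by (rule vec_eq_by_numbering[OF e_f]) (auto simp: outer_args_nth[OF e_f] axis_def e_f_eq)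
    next
      fix a t x assume "a \<in> A"
      then obtain m where m: "a = e m" "l < m" "m \<le> k" by (auto simp: A_def)
      have "m - l \<in> {1..n - l}" using m kln by auto
      then have j: "e\<^sub>g j = e\<^sub>g (m - l) \<longleftrightarrow> l + j = m" if "j \<in> {1..n - l}" for j
        using e_g_eq[OF that] m by auto
      show "?\<kappa> (x + t *\<^sub>R axis a 1) = ?\<kappa> x + t *\<^sub>R axis (e\<^sub>g (\<nu> a - l)) 1"
        using m kln by (intro vec_eq_by_numbering[OF e_g])
          (auto simp: inner_args_nth[OF e_g] axis_def \<nu>e e_eq j)
      show "?\<omega> s (x + t *\<^sub>R axis a 1) = ?\<omega> s x" for s
      proof (rule vec_eq_by_numbering[OF e_f])
        fix j assume j: "j \<in> {1..n - k + l + 1}"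
        consider "j \<le> l" | "j = l + 1" | "l + 1 < j" by linarith
        then show "?\<omega> s (x + t *\<^sub>R axis a 1) $ e\<^sub>f j = ?\<omega> s x $ e\<^sub>f j"
          unfolding vector_add_component vector_scaleR_component outer_args_nth[OF e_f j]
          by cases (use m kln j tail[OF j, of m] e_eq[of j m] in \<open>simp_all add: axis_def\<close>)
      qed
    next
      fix p t x assume "p \<in> L"
      then obtain m where m: "p = e m" "1 \<le> m" "m \<le> l" by (auto simp: L_def)
      show "?\<kappa> (x + t *\<^sub>R axis p 1) = ?\<kappa> x"
        using m kln by (intro vec_eq_by_numbering[OF e_g])
          (auto simp: inner_args_nth[OF e_g] axis_def e_eq)
      show "?\<omega> s (x + t *\<^sub>R axis p 1) = ?\<omega> s x + t *\<^sub>R axis (e\<^sub>f (\<nu> p)) 1" for s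
      proof (rule vec_eq_by_numbering[OF e_f])
        fix j assume j: "j \<in> {1..n - k + l + 1}"
        have mf: "m \<in> {1..n - k + l + 1}" using m by auto
        consider "j \<le> l" | "j = l + 1" | "l + 1 < j" by linarith
        then show "?\<omega> s (x + t *\<^sub>R axis p 1) $ e\<^sub>f j = (?\<omega> s x + t *\<^sub>R axis (e\<^sub>f (\<nu> p)) 1) $ e\<^sub>f j"
          unfolding vector_add_component vector_scaleR_component outer_args_nth[OF e_f j]
          by cases (use m kln j tail[OF j, of m] e_eq[of j m] e_f_eq[OF j mf] \<nu>e[of m] in \<open>simp_all add: axis_def\<close>)
      qed
    qed
  qed
qed

end
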